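(* Let $P(z)=\sum_{j=0}^{m}A_jz^j$, with $A_j\in\mathbb{M}_{n,n}$, be a matrix polynomial of degree $m\ge 1$, where $A_m$ is invertible. Suppose that for some real $t>0$, $$\|A_m^{-1}\|^{-1}\ge t\|A_{m-1}\|\ge t^2\|A_{m-2}\|\ge\cdots\ge t^m\|A_0\|,\qquad A_0>0.$$ Then all eigenvalues of $P(z)$ lie in $|z|\le k_1/t$, where $k_1$ is the greatest positive root of the trinomial equation $K^{m+1}-2K^m+1=0$.
   Context: $\mathbb{M}_{n,n}$ denotes the set of $n\times n$ complex matrices. A matrix polynomial of degree $m$ is a function $P:\mathbb{C}\to\mathbb{M}_{n,n}$, $P(z)=\sum_{j=0}^m A_jz^j$ with $A_j\in\mathbb{M}_{n,n}$ and $A_m\ne 0$. An eigenvalue of $P(z)$ is a number $\lambda\in\mathbb{C}$ for which there is a non-zero vector $u\in\mathbb{C}^n$ with $P(\lambda)u=0$. $\|\cdot\|$ denotes a subordinate matrix norm, i.e. the operator norm on $\mathbb{M}_{n,n}$ induced by a vector norm on $\mathbb{C}^n$. $A>0$ means that $A$ is positive definite (Hermitian). *)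

theory Defs
  imports "HOL-Analysis.Analysis"
begin

definition mat_scale :: "complex \<Rightarrow> complex ^ 'n ^ 'n \<Rightarrow> complex ^ 'n ^ 'n" where
  "mat_scale c A = map_matrix (\<lambda>a. c * a) A"

definition matrix_poly :: "nat \<Rightarrow> (nat \<Rightarrow> complex ^ 'n ^ 'n) \<Rightarrow> complex \<Rightarrow> complex ^ 'n ^ 'n" where
  "matrix_poly m A z = (\<Sum>j\<le>m. mat_scale (z ^ j) (A j))"

definition is_eigenvalue :: "(complex \<Rightarrow> complex ^ 'n ^ 'n) \<Rightarrow> complex \<Rightarrow> bool" where
  "is_eigenvalue P z \<longleftrightarrow> (\<exists>u. u \<noteq> 0 \<and> P z *v u = 0)"

(* An arbitrary norm on C^n; the type class norm on this type is only the Euclidean one. *)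
definition vector_norm :: "(complex ^ 'n \<Rightarrow> real) \<Rightarrow> bool" where
  "vector_norm N \<longleftrightarrow>
     (\<forall>x. 0 \<le> N x) \<and>
     (\<forall>x. N x = 0 \<longleftrightarrow> x = 0) \<and>
     (\<forall>c x. N (c *s x) = cmod c * N x) \<and>
     (\<forall>x y. N (x + y) \<le> N x + N y)"

(* For a vector norm N the supremum is over a nonempty set that is bounded above. *)
definition subordinate_norm :: "(complex ^ 'n \<Rightarrow> real) \<Rightarrow> complex ^ 'n ^ 'n \<Rightarrow> real" where
  "subordinate_norm N A = (SUP x\<in>{x. N x = 1}. N (A *v x))"

definition hermitian :: "complex ^ 'n ^ 'n \<Rightarrow> bool" where
  "hermitian A \<longleftrightarrow> (\<forall>i j. A $ i $ j = cnj (A $ j $ i))"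

(* The Hermitian form is real for Hermitian A, so Re discards nothing. *)
definition positive_definite :: "complex ^ 'n ^ 'n \<Rightarrow> bool" where
  "positive_definite A \<longleftrightarrow> hermitian A \<and>
     (\<forall>x. x \<noteq> 0 \<longrightarrow> 0 < Re (\<Sum>i\<in>UNIV. cnj (x $ i) * (A *v x) $ i))"

(* K = 1 is always a root, so for m > 0 the greatest positive root exists. *)
definition trinomial_root :: "nat \<Rightarrow> real" where
  "trinomial_root m = (GREATEST K. 0 < K \<and> K ^ (m + 1) - 2 * K ^ m + 1 = 0)"

end

theory Submission
  imports Defs
begin

text \<open>
  If \<open>P(z) u = 0\<close> with \<open>u \<noteq> 0\<close>, isolating the leading term and using the chain of inequalities in the
  form \<open>t^j \<parallel>A_(m-j)\<parallel> \<le> \<parallel>A_m\<inverse>\<parallel>\<inverse>\<close> shows that \<open>K = t |z|\<close> satisfies \<open>K^m \<le> 1 + K + \<dots> + K^(m-1)\<close>.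
  For \<open>K > 1\<close> multiplying by \<open>K - 1\<close> turns this into \<open>K^(m+1) - 2 K^m + 1 \<le> 0\<close>; the trinomial is
  positive from \<open>2\<close> onwards, so it has a root in \<open>[K, 2]\<close>.
\<close>

section \<open>The greatest positive root of the trinomial\<close>

lemma trinomial_pos:
  fixes K :: real
  assumes "K \<ge> 2"
  shows "0 < K ^ (m + 1) - 2 * K ^ m + 1"
proof -
  have "0 \<le> K ^ m * (K - 2)" using assms by simp
  then show ?thesis by (simp add: algebra_simps)
qed

text \<open>\<open>GREATEST\<close> says something only once a maximum is known to exist. The roots
  in \<open>{1..2}\<close> form a compact set containing \<open>1\<close>, hence have a maximum;
  every other positive root lies below \<open>1\<close>, since there are none from \<open>2\<close>
  onwards.\<close>

lemma trinomial_root_greatest: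
  assumes "0 < K" "K ^ (m + 1) - 2 * K ^ m + 1 = 0"
  shows "K \<le> trinomial_root m"
proof -
  define R where "R = {K. (0::real) < K \<and> K ^ (m + 1) - 2 * K ^ m + 1 = 0}"
  define S where "S = {1..2} \<inter> {K::real. K ^ (m + 1) - 2 * K ^ m + 1 = 0}"
  have "closed {K::real. K ^ (m + 1) - 2 * K ^ m + 1 = 0}"
    by (intro closed_Collect_eq continuous_intros)
  then have "compact S" unfolding S_def by (intro compact_Int_closed) auto
  moreover have "1 \<in> S" by (simp add: S_def)
  ultimately obtain k where k: "k \<in> S" "\<And>x. x \<in> S \<Longrightarrow> x \<le> k"
    using compact_attains_sup[of S] by blast
  have kR: "0 < k \<and> k ^ (m + 1) - 2 * k ^ m + 1 = 0" using k(1) by (auto simp: S_def)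
  have ub: "x \<le> k" if "0 < x \<and> x ^ (m + 1) - 2 * x ^ m + 1 = 0" for x
  proof (cases "x < 1")
    case True
    then show ?thesis using k(2)[OF \<open>1 \<in> S\<close>] by simp
  next
    case False
    have "x \<le> 2" using trinomial_pos[of x m] that by linarith
    then show ?thesis using False that by (intro k(2)) (simp add: S_def)
  qed
  have "trinomial_root m = k"
    unfolding trinomial_root_def using kR ub by (intro Greatest_equality) auto
  then show ?thesis using ub assms by blast
qed

lemma le_trinomial_root:
  fixes K :: real
  assumes "K \<ge> 1" "K ^ (m + 1) - 2 * K ^ m + 1 \<le> 0"
  shows "K \<le> trinomial_root m"
proof -
  have "K \<le> 2" using trinomial_pos[of K m] assms(2) by linarith
  moreover have "continuous_on {K..2} (\<lambda>x. x ^ (m + 1) - 2 * x ^ m + 1)"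
    by (intro continuous_intros)
  ultimately obtain x where x: "K \<le> x" "x ^ (m + 1) - 2 * x ^ m + 1 = 0"
    using IVT'[of "\<lambda>x. x ^ (m + 1) - 2 * x ^ m + 1" K 0 2] assms(2) trinomial_pos[of 2 m]
    by auto
  then show ?thesis using trinomial_root_greatest[of x m] assms(1) by linarith
qed

lemma le_trinomial_root_of_power_le_sum:
  fixes K :: real
  assumes "K ^ m \<le> (\<Sum>j<m. K ^ j)"
  shows "K \<le> trinomial_root m"
proof (cases "K \<ge> 1")
  case True
  have "(K - 1) * K ^ m \<le> (K - 1) * (\<Sum>j<m. K ^ j)"
    using True assms by (intro mult_left_mono) auto
  also have "\<dots> = K ^ m - 1" by (simp add: power_diff_1_eq)
  finally show ?thesis using True by (intro le_trinomial_root) (simp_all add: algebra_simps)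
next
  case False
  \<comment> \<open>\<open>1\<close> is always a root of the trinomial, so the greatest root is at
    least \<open>1\<close> and exceeds \<open>K\<close>.\<close>
  then show ?thesis using trinomial_root_greatest[of 1 m] by simp
qed

section \<open>Arbitrary norms on \<open>complex ^ 'n\<close> and their subordinate matrix
  norms\<close>

lemma vector_norm_zero: "vector_norm N \<Longrightarrow> N 0 = 0"
  unfolding vector_norm_def by blast

lemma vector_norm_sum:
  assumes "vector_norm N" "finite S"
  shows "N (sum f S) \<le> (\<Sum>i\<in>S. N (f i))"
  using assms(2)
proof (induction S rule: finite_induct)
  case empty
  then show ?case using vector_norm_zero[OF assms(1)] by simp
next
  case (insert x S)
  have "N (f x + sum f S) \<le> N (f x) + N (sum f S)"
    using assms(1) by (simp add: vector_norm_def)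
  then show ?case using insert by simp
qed

lemma vector_norm_uminus:
  assumes "vector_norm N"
  shows "N (- x) = N x"
proof -
  have "N ((-1) *s x) = cmod (-1) * N x" using assms unfolding vector_norm_def by blast
  moreover have "(-1) *s x = - x" by (simp add: vec_eq_iff)
  ultimately show ?thesis by simp
qed

text \<open>Expanding \<open>A *v x\<close> in the columns of \<open>A\<close> gives the bound. With
  \<open>A = mat 1\<close> it is one half of the equivalence of \<open>N\<close> with the Euclidean
  norm.\<close>

lemma vector_norm_mult_le_norm:
  fixes N :: "complex ^ 'n \<Rightarrow> real" and A :: "complex ^ 'n ^ 'n"
  assumes "vector_norm N"
  obtains C where "C \<ge> 0" "\<And>x. N (A *v x) \<le> C * norm x"
proof
  let ?C = "\<Sum>i\<in>UNIV. N (column i A)"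
  show "?C \<ge> 0" using assms by (auto intro!: sum_nonneg simp: vector_norm_def)
  fix x :: "complex ^ 'n"
  have "N (A *v x) = N (\<Sum>i\<in>UNIV. (x $ i) *s column i A)" by (simp add: matrix_mult_sum)
  also have "\<dots> \<le> (\<Sum>i\<in>UNIV. N ((x $ i) *s column i A))"
    using assms by (intro vector_norm_sum) auto
  also have "\<dots> = (\<Sum>i\<in>UNIV. cmod (x $ i) * N (column i A))"
    using assms by (simp add: vector_norm_def)
  also have "\<dots> \<le> (\<Sum>i\<in>UNIV. norm x * N (column i A))"
    using assms by (intro sum_mono mult_right_mono Finite_Cartesian_Product.norm_nth_le) (auto simp: vector_norm_def)
  finally show "N (A *v x) \<le> ?C * norm x" by (simp add: sum_distrib_left mult.commute)
qed

lemma continuous_on_vector_norm: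
  fixes N :: "complex ^ 'n \<Rightarrow> real"
  assumes "vector_norm N"
  shows "continuous_on S N"
proof -
  obtain C where C: "C \<ge> 0" "\<And>x. N (mat 1 *v x) \<le> C * norm x"
    using vector_norm_mult_le_norm[OF assms] by metis
  have "N x - N y \<le> C * norm (x - y)" for x y
  proof -
    have "N ((x - y) + y) \<le> N (x - y) + N y" using assms unfolding vector_norm_def by blast
    then show ?thesis using C(2)[of "x - y"] by simp
  qed
  then have "dist (N x) (N y) \<le> C * dist x y" for x y
    by (metis abs_le_iff dist_norm minus_diff_eq norm_minus_commute real_norm_def)
  then have "C-lipschitz_on S N" using C(1) by (intro lipschitz_onI)
  then show ?thesis by (rule lipschitz_on_continuous_on)
qed

text \<open>The other half of norm equivalence: \<open>c\<close> is the minimum of the continuous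
  \<open>N\<close> on the compact Euclidean unit sphere, positive because \<open>0\<close> is not on
  it. Homogeneity carries the bound to all vectors.\<close>

lemma norm_le_vector_norm:
  fixes N :: "complex ^ 'n \<Rightarrow> real"
  assumes "vector_norm N"
  obtains c where "c > 0" "\<And>x. c * norm x \<le> N x"
proof -
  have "sphere (0::complex ^ 'n) 1 \<noteq> {}" by simp
  then obtain s where s: "s \<in> sphere 0 1" "\<And>y. y \<in> sphere 0 1 \<Longrightarrow> N s \<le> N y"
    using continuous_attains_inf[OF compact_sphere _ continuous_on_vector_norm[OF assms]] by blast
  have "N s * norm x \<le> N x" for x
  proof (cases "x = 0")
    case True
    then show ?thesis using vector_norm_zero[OF assms] by simp
  next
    case False
    define y where "y = complex_of_real (inverse (norm x)) *s x"
    \<comment> \<open>Homogeneity of \<open>N\<close> is stated for the complex scaling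
      \<open>*s\<close>, whereas the Euclidean norm of \<open>y\<close> is computed from real
      scaling.\<close>
    have "y = inverse (norm x) *\<^sub>R x" unfolding vec_eq_iff y_def vector_scalar_mult_def
      by (simp only: vec_lambda_beta vector_scaleR_component) (simp add: scaleR_conv_of_real)
    then have "N s \<le> N y" using False by (intro s(2)) simp
    also have "N y = cmod (complex_of_real (inverse (norm x))) * N x"
      using assms unfolding y_def vector_norm_def by blast
    also have "\<dots> = inverse (norm x) * N x" by (simp only: norm_of_real) simp
    finally show ?thesis using False by (simp add: field_simps)
  qed
  moreover have "N s > 0"
  proof -
    have "s \<noteq> 0" using s(1) by auto
    then show ?thesis using assms unfolding vector_norm_def by (metis less_eq_real_def)
  qed
  ultimately show thesis using that by blast
qed

lemma subordinate_norm_bound: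
  fixes N :: "complex ^ 'n \<Rightarrow> real"
  assumes "vector_norm N"
  shows "N (A *v x) \<le> subordinate_norm N A * N x"
proof (cases "x = 0")
  case True
  then show ?thesis using vector_norm_zero[OF assms] by simp
next
  case False
  obtain C where C: "C \<ge> 0" "\<And>x. N (A *v x) \<le> C * norm x"
    using vector_norm_mult_le_norm[OF assms] by metis
  obtain c where c: "c > 0" "\<And>x. c * norm x \<le> N x"
    using norm_le_vector_norm[OF assms] by metis
  \<comment> \<open>A real \<open>SUP\<close> bounds its elements only if they are bounded above.
    Norm equivalence confines the unit sphere of \<open>N\<close> to the Euclidean ball of radius
    \<open>1 / c\<close>.\<close>
  have bdd: "bdd_above ((\<lambda>x. N (A *v x)) ` {x. N x = 1})"
  proof (rule bdd_aboveI2)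
    fix y assume "y \<in> {x. N x = 1}"
    then have "norm y \<le> 1 / c" using c(2)[of y] c(1) by (simp add: field_simps)
    then have "C * norm y \<le> C * (1 / c)" using C(1) by (rule mult_left_mono)
    then show "N (A *v y) \<le> C * (1 / c)" using C(2)[of y] by linarith
  qed
  have pos: "N x > 0" using False assms unfolding vector_norm_def by (metis less_eq_real_def)
  have scale: "N (c *s v) = cmod c * N v" for c v
    using assms unfolding vector_norm_def by blast
  define y where "y = complex_of_real (inverse (N x)) *s x"
  have "N y = 1" using pos by (simp add: y_def scale norm_inverse)
  then have "N (A *v y) \<le> subordinate_norm N A"
    unfolding subordinate_norm_def using bdd by (intro cSUP_upper) auto
  moreover have "N (A *v y) = inverse (N x) * N (A *v x)"
    using pos by (simp only: y_def vector_scalar_commute scale norm_of_real) simp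
  ultimately show ?thesis using pos by (simp add: field_simps)
qed

section \<open>Matrix polynomials and the bound on their eigenvalues\<close>

lemma mat_scale_mult_vec: "mat_scale c A *v x = c *s (A *v x)"
  by (simp add: mat_scale_def map_matrix_def matrix_vector_mult_def vec_eq_iff
      sum_distrib_left mult.assoc)

lemma matrix_poly_mult_vec:
  fixes A :: "nat \<Rightarrow> complex ^ 'n ^ 'n"
  shows "matrix_poly m A z *v u = (\<Sum>j\<le>m. z ^ j *s (A j *v u))"
proof -
  have "(\<Sum>j\<in>S. B j) *v u = (\<Sum>j\<in>S. B j *v u)" if "finite S"
    for S :: "nat set" and B :: "nat \<Rightarrow> complex ^ 'n ^ 'n"
    using that by (induction S rule: finite_induct) (simp_all add: matrix_vector_mult_add_rdistrib)
  then show ?thesis by (simp add: matrix_poly_def mat_scale_mult_vec)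
qed

lemma matrix_poly_eigenvector_bound:
  fixes N :: "complex ^ 'n \<Rightarrow> real"
  assumes N: "vector_norm N"
    and "matrix_poly m A z *v u = 0"
  shows "cmod z ^ m * N (A m *v u) \<le> (\<Sum>j<m. cmod z ^ j * subordinate_norm N (A j)) * N u"
proof -
  have scale: "N (c *s v) = cmod c * N v" for c v
    using N unfolding vector_norm_def by blast
  have "{..m} = insert m {..<m}" by auto
  then have "z ^ m *s (A m *v u) = - (\<Sum>j<m. z ^ j *s (A j *v u))"
    using assms(2) by (simp add: matrix_poly_mult_vec eq_neg_iff_add_eq_0)
  then have "cmod z ^ m * N (A m *v u) = N (\<Sum>j<m. z ^ j *s (A j *v u))"
    by (metis scale norm_power vector_norm_uminus[OF N])
  also have "\<dots> \<le> (\<Sum>j<m. N (z ^ j *s (A j *v u)))"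
    using N by (intro vector_norm_sum) auto
  also have "\<dots> = (\<Sum>j<m. cmod z ^ j * N (A j *v u))" by (simp add: scale norm_power)
  also have "\<dots> \<le> (\<Sum>j<m. cmod z ^ j * (subordinate_norm N (A j) * N u))"
    by (intro sum_mono mult_left_mono subordinate_norm_bound N) auto
  finally show ?thesis by (simp add: sum_distrib_right mult.assoc)
qed

text \<open>Both claims come from \<open>u = matrix_inv B *v (B *v u)\<close>, which gives
  \<open>N u \<le> ?s * N (B *v u)\<close>. As \<open>N u > 0\<close>, this forces
  \<open>?s > 0\<close>, and dividing by \<open>?s\<close> is then legitimate.\<close>

lemma invertible_subordinate_norm:
  fixes N :: "complex ^ 'n \<Rightarrow> real"
  assumes N: "vector_norm N" and "invertible B" and "u \<noteq> 0"
  shows "0 < subordinate_norm N (matrix_inv B)"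
    and "inverse (subordinate_norm N (matrix_inv B)) * N u \<le> N (B *v u)"
proof -
  let ?s = "subordinate_norm N (matrix_inv B)"
  have "B ** matrix_inv B = mat 1 \<and> matrix_inv B ** B = mat 1"
    using assms(2) unfolding invertible_def matrix_inv_def by (rule someI_ex)
  then have "matrix_inv B *v (B *v u) = u" by (simp add: matrix_vector_mul_assoc)
  then have le: "N u \<le> ?s * N (B *v u)"
    using subordinate_norm_bound[OF N, of "matrix_inv B" "B *v u"] by simp
  have "N u > 0" "N (B *v u) \<ge> 0"
    using assms(3) N unfolding vector_norm_def by (metis less_eq_real_def, blast)
  then show pos: "0 < ?s" using le by (metis less_le_trans zero_less_mult_pos2 less_eq_real_def mult_zero_right)
  show "inverse ?s * N u \<le> N (B *v u)" using le pos by (simp add: field_simps)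
qed

theorem theorem1:
  fixes N :: "complex ^ 'n \<Rightarrow> real"
    and A :: "nat \<Rightarrow> complex ^ 'n ^ 'n"
    and m :: nat
    and t :: real
  assumes "vector_norm N"
    and "m \<ge> 1"
    and "A m \<noteq> 0"
    and "invertible (A m)"
    and "t > 0"
    and "inverse (subordinate_norm N (matrix_inv (A m))) \<ge> t * subordinate_norm N (A (m - 1))"
    and "\<And>j. 1 \<le> j \<Longrightarrow> j < m \<Longrightarrow>
           t ^ j * subordinate_norm N (A (m - j)) \<ge> t ^ (j + 1) * subordinate_norm N (A (m - (j + 1)))"
    and "positive_definite (A 0)"
  shows "\<forall>z. is_eigenvalue (matrix_poly m A) z \<longrightarrow> cmod z \<le> trinomial_root m / t"
proof (intro allI impI)
  fix z assume "is_eigenvalue (matrix_poly m A) z"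
  then obtain u where u: "u \<noteq> 0" "matrix_poly m A z *v u = 0"
    by (auto simp: is_eigenvalue_def)
  define a where "a = inverse (subordinate_norm N (matrix_inv (A m)))"
  note inv = invertible_subordinate_norm[OF assms(1,4) u(1)]
  have a: "a > 0" using inv(1) by (simp add: a_def)
  have Nu: "N u > 0" using u(1) assms(1) unfolding vector_norm_def by (metis less_eq_real_def)
  \<comment> \<open>Here \<open>j\<close> counts down from the leading coefficient. The induction
    starts at \<open>1\<close>, because the first link of the chain has \<open>a\<close> where the
    norm of \<open>A m\<close> would stand.\<close>
  have coeff: "t ^ j * subordinate_norm N (A (m - j)) \<le> a" if "1 \<le> j" "j \<le> m" for j
    using that
  proof (induction j rule: dec_induct)
    case base
    then show ?case using assms(6) by (simp add: a_def)
  next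
    case (step j)
    then show ?case using assms(7)[of j] by simp
  qed
  define K where "K = t * cmod z"
  have "a * cmod z ^ m * N u \<le> cmod z ^ m * N (A m *v u)"
    using mult_left_mono[OF inv(2), of "cmod z ^ m"] by (simp add: a_def mult_ac)
  also have "\<dots> \<le> (\<Sum>j<m. cmod z ^ j * subordinate_norm N (A j)) * N u"
    by (rule matrix_poly_eigenvector_bound[OF assms(1) u(2)])
  finally have "a * cmod z ^ m \<le> (\<Sum>j<m. cmod z ^ j * subordinate_norm N (A j))"
    using Nu by simp
  \<comment> \<open>In each term \<open>t ^ m\<close> splits as \<open>t ^ j * t ^ (m - j)\<close>:
    the first factor turns \<open>cmod z ^ j\<close> into \<open>K ^ j\<close>, the second gives the
    weight that \<open>coeff\<close> bounds by \<open>a\<close>.\<close>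
  then have "t ^ m * (a * cmod z ^ m) \<le> t ^ m * (\<Sum>j<m. cmod z ^ j * subordinate_norm N (A j))"
    using assms(5) by (intro mult_left_mono) auto
  also have "\<dots> = (\<Sum>j<m. K ^ j * (t ^ (m - j) * subordinate_norm N (A j)))"
    unfolding sum_distrib_left
  proof (intro sum.cong refl)
    fix j assume "j \<in> {..<m}"
    then have "t ^ m = t ^ j * t ^ (m - j)" by (simp flip: power_add)
    then show "t ^ m * (cmod z ^ j * subordinate_norm N (A j)) =
        K ^ j * (t ^ (m - j) * subordinate_norm N (A j))"
      by (simp add: K_def power_mult_distrib)
  qed
  also have "\<dots> \<le> (\<Sum>j<m. K ^ j * a)"
  proof (intro sum_mono mult_left_mono)
    fix j assume "j \<in> {..<m}"
    then show "t ^ (m - j) * subordinate_norm N (A j) \<le> a" using coeff[of "m - j"] by simp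
  qed (use assms(5) in \<open>simp add: K_def\<close>)
  also have "\<dots> = a * (\<Sum>j<m. K ^ j)" by (simp add: sum_distrib_left mult.commute)
  finally have "a * K ^ m \<le> a * (\<Sum>j<m. K ^ j)" by (simp add: K_def power_mult_distrib mult_ac)
  then have "K \<le> trinomial_root m"
    using a by (intro le_trinomial_root_of_power_le_sum) simp
  then show "cmod z \<le> trinomial_root m / t"
    using assms(5) by (simp add: K_def field_simps)
qed

end
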